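(* Let $G = F_{n_k} \rtimes F_{n_{k-1}} \rtimes \cdots \rtimes F_{n_1}$ be an almost-direct product of free groups, with a Magnus-type ordering with positive cone $\mathcal{P}(F_{n_i})$ fixed on each free factor $F_{n_i}$. Let $P \subset G$ be the set of all $g$ with normal form $g = g_k\cdots g_1$ ($g_i \in F_{n_i}$) for which there is $j \in \{1,\dots,k\}$ with $g_j \in \mathcal{P}(F_{n_j})$ and $g_i = 1$ for all $i > j$. Suppose that $\varphi \in \operatorname{Aut}(G)$ satisfies: (i) $\varphi(F_{n_j}) = F_{n_j}$ for all $j$; (ii) for all $j$, the restriction $\varphi|_{F_{n_j}}$ preserves the Magnus-type ordering on $F_{n_j}$. Then $\varphi(P) = P$. In particular, $\varphi$ preserves the lexicographic ordering on $G$ given by $g<h \iff g^{-1}h\in P$.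
   Context: Almost-direct products. Let $F_{n_1},\dots,F_{n_k}$ be free groups of finite ranks $n_1,\dots,n_k$. The iterated semidirect product $G = F_{n_k} \rtimes \cdots \rtimes F_{n_1}$ is read as follows: $G_1 = F_{n_1}$, $G_i = F_{n_i} \rtimes G_{i-1}$ for $i \ge 2$ (so $F_{n_i}$ is normal in $G_i$ and $G_{i-1}$ acts on $F_{n_i}$), and $G = G_k$. It is an almost-direct product of free groups if for each $i\ge 2$ the action of $G_{i-1}$ on $F_{n_i}$ induces the trivial action on the abelianization $F_{n_i}/[F_{n_i},F_{n_i}]$. Every $g \in G$ can be written uniquely as $g = g_k g_{k-1}\cdots g_1$ with $g_i \in F_{n_i}$; this is the normal form of $g$. Magnus-type ordering on the free group $F_n$: fix a free basis $x_1,\dots,x_n$ and let $\mu\colon F_n \to \mathbb{Z}\langle\langle X_1,\dots,X_n\rangle\rangle$ be the Magnus embedding into the ring of formal power series in noncommuting variables, $\mu(x_i) = 1 + X_i$. Order monomials first by degree and then lexicographically within each degree. An element $g \ne 1$ belongs to the positive cone $\mathcal{P}(F_n)$ iff the coefficient of the smallest monomial occurring with nonzero coefficient in $\mu(g) - 1$ is positive. The ordering on $F_n$ is $g<h \iff g^{-1}h\in\mathcal{P}(F_n)$. An automorphism $\psi$ preserves an ordering $<$ if $g<h$ implies $\psi(g)<\psi(h)$. *)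

theory Defs
  imports "HOL-Algebra.Algebra"
begin

section \<open>Free groups\<close>

text \<open>A letter \<open>(i, True)\<close> stands for \<open>x\<^sub>i\<close> and \<open>(i, False)\<close> for the inverse of \<open>x\<^sub>i\<close>.\<close>

fun letter_eval :: "('a, 'b) monoid_scheme \<Rightarrow> (nat \<Rightarrow> 'a) \<Rightarrow> nat \<times> bool \<Rightarrow> 'a" where
  "letter_eval H x (i, e) = (if e then x i else inv\<^bsub>H\<^esub> (x i))"

definition word_eval :: "('a, 'b) monoid_scheme \<Rightarrow> (nat \<Rightarrow> 'a) \<Rightarrow> (nat \<times> bool) list \<Rightarrow> 'a" where
  "word_eval H x w = foldr (\<otimes>\<^bsub>H\<^esub>) (map (letter_eval H x) w) \<one>\<^bsub>H\<^esub>"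

definition reduced_words :: "nat \<Rightarrow> (nat \<times> bool) list set" where
  "reduced_words n =
     {w. fst ` set w \<subseteq> {1..n} \<and> successively (\<lambda>a b. \<not> (fst a = fst b \<and> snd a \<noteq> snd b)) w}"

definition free_basis :: "('a, 'b) monoid_scheme \<Rightarrow> nat \<Rightarrow> (nat \<Rightarrow> 'a) \<Rightarrow> bool" where
  "free_basis H n x \<longleftrightarrow> x \<in> {1..n} \<rightarrow> carrier H \<and>
     bij_betw (word_eval H x) (reduced_words n) (carrier H)"

definition free_group_of_rank :: "('a, 'b) monoid_scheme \<Rightarrow> nat \<Rightarrow> bool" where
  "free_group_of_rank H n \<longleftrightarrow> group H \<and> (\<exists>x. free_basis H n x)"


section \<open>Almost-direct products of free groups\<close>

definition internal_semidirect ::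
    "('a, 'b) monoid_scheme \<Rightarrow> 'a set \<Rightarrow> 'a set \<Rightarrow> bool" where
  "internal_semidirect H N K \<longleftrightarrow> N \<lhd> H \<and> subgroup K H \<and>
     N <#>\<^bsub>H\<^esub> K = carrier H \<and> N \<inter> K = {\<one>\<^bsub>H\<^esub>}"

primrec stage :: "('a, 'b) monoid_scheme \<Rightarrow> (nat \<Rightarrow> 'a set) \<Rightarrow> nat \<Rightarrow> 'a set" where
  "stage G F 0 = {\<one>\<^bsub>G\<^esub>}"
| "stage G F (Suc i) = F (Suc i) <#>\<^bsub>G\<^esub> stage G F i"

text \<open>
  The iterated semidirect product is rendered internally: the free factors \<open>F 1, \<dots>, F k\<close> are
  subgroups of \<open>G\<close>, and \<open>stage G F i\<close>, the set \<open>F\<^sub>i \<cdots> F\<^sub>1\<close>, is the subgroup \<open>G\<^sub>i\<close>. The action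
  of \<open>G\<^sub>i\<^sub>-\<^sub>1\<close> on \<open>F\<^sub>i\<close> is conjugation in \<open>G\<close>; it is trivial on the abelianization iff
  \<open>g h g\<^sup>-\<^sup>1\<close> and \<open>h\<close> always lie in the same coset of the commutator subgroup of \<open>F\<^sub>i\<close>.
\<close>

definition almost_direct_product ::
    "('a, 'b) monoid_scheme \<Rightarrow> nat \<Rightarrow> (nat \<Rightarrow> nat) \<Rightarrow> (nat \<Rightarrow> 'a set) \<Rightarrow> bool" where
  "almost_direct_product G k n F \<longleftrightarrow>
     group G \<and> 1 \<le> k \<and>
     (\<forall>i\<in>{1..k}. subgroup (F i) G \<and> free_group_of_rank (G\<lparr>carrier := F i\<rparr>) (n i)) \<and>
     (\<forall>i\<in>{2..k}. subgroup (stage G F i) G \<and>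
        internal_semidirect (G\<lparr>carrier := stage G F i\<rparr>) (F i) (stage G F (i - 1))) \<and>
     stage G F k = carrier G \<and>
     (\<forall>i\<in>{2..k}. \<forall>g\<in>stage G F (i - 1). \<forall>h\<in>F i.
        derived G (F i) #>\<^bsub>G\<^esub> (g \<otimes>\<^bsub>G\<^esub> h \<otimes>\<^bsub>G\<^esub> inv\<^bsub>G\<^esub> g) = derived G (F i) #>\<^bsub>G\<^esub> h)"

definition normal_form ::
    "('a, 'b) monoid_scheme \<Rightarrow> nat \<Rightarrow> (nat \<Rightarrow> 'a set) \<Rightarrow> 'a \<Rightarrow> (nat \<Rightarrow> 'a) \<Rightarrow> bool" where
  "normal_form G k F g c \<longleftrightarrow> (\<forall>i\<in>{1..k}. c i \<in> F i) \<and>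
     g = foldr (\<otimes>\<^bsub>G\<^esub>) (map c (rev [1..<Suc k])) \<one>\<^bsub>G\<^esub>"


section \<open>Formal power series in noncommuting variables\<close>

text \<open>
  A monomial in \<open>X\<^sub>1, \<dots>, X\<^sub>n\<close> is a list over \<open>{1..n}\<close>, and a series is its coefficient function.
  The coefficient of \<open>w\<close> in a product sums over all factorizations \<open>w = u v\<close>.
\<close>

definition nc_series_ring :: "nat \<Rightarrow> (nat list \<Rightarrow> int) ring" where
  "nc_series_ring n =
     \<lparr>partial_object.carrier = {f. \<forall>w. f w \<noteq> 0 \<longrightarrow> set w \<subseteq> {1..n}},
      monoid.mult = (\<lambda>f g w. \<Sum>i\<le>length w. f (take i w) * g (drop i w)),
      monoid.one = (\<lambda>w. if w = [] then 1 else 0),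
      ring.zero = (\<lambda>w. 0),
      ring.add = (\<lambda>f g w. f w + g w)\<rparr>"

definition nc_var :: "nat \<Rightarrow> nat list \<Rightarrow> int" where
  "nc_var i = (\<lambda>w. if w = [i] then 1 else 0)"


section \<open>Magnus embedding and Magnus-type ordering\<close>

text \<open>The values of the Magnus map are units, so it is a homomorphism into the group of units.\<close>

definition is_magnus_map ::
    "('a, 'b) monoid_scheme \<Rightarrow> nat \<Rightarrow> (nat \<Rightarrow> 'a) \<Rightarrow> ('a \<Rightarrow> nat list \<Rightarrow> int) \<Rightarrow> bool" where
  "is_magnus_map H n x \<mu> \<longleftrightarrow>
     \<mu> \<in> hom H (units_of (nc_series_ring n)) \<and> \<mu> \<in> extensional (carrier H) \<and>
     (\<forall>i\<in>{1..n}. \<mu> (x i) = \<one>\<^bsub>nc_series_ring n\<^esub> \<oplus>\<^bsub>nc_series_ring n\<^esub> nc_var i)"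

definition magnus :: "('a, 'b) monoid_scheme \<Rightarrow> nat \<Rightarrow> (nat \<Rightarrow> 'a) \<Rightarrow> 'a \<Rightarrow> nat list \<Rightarrow> int" where
  "magnus H n x = (THE \<mu>. is_magnus_map H n x \<mu>)"

text \<open>
  The relation \<open>lenlex less_than\<close> compares monomials by degree and then lexicographically with
  \<open>X\<^sub>1 < \<dots> < X\<^sub>n\<close>; below, \<open>w\<close> is the smallest monomial occurring in \<open>\<mu>(g) - 1\<close>.
\<close>

definition magnus_cone :: "('a, 'b) monoid_scheme \<Rightarrow> nat \<Rightarrow> (nat \<Rightarrow> 'a) \<Rightarrow> 'a set" where
  "magnus_cone H n x =
     {g \<in> carrier H. g \<noteq> \<one>\<^bsub>H\<^esub> \<and>
        (let f = magnus H n x g \<ominus>\<^bsub>nc_series_ring n\<^esub> \<one>\<^bsub>nc_series_ring n\<^esub>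
         in \<exists>w. f w > 0 \<and> (\<forall>v. (v, w) \<in> lenlex less_than \<longrightarrow> f v = 0))}"

definition cone_less :: "('a, 'b) monoid_scheme \<Rightarrow> 'a set \<Rightarrow> 'a \<Rightarrow> 'a \<Rightarrow> bool" where
  "cone_less G P g h \<longleftrightarrow> inv\<^bsub>G\<^esub> g \<otimes>\<^bsub>G\<^esub> h \<in> P"

definition lex_cone ::
    "('a, 'b) monoid_scheme \<Rightarrow> nat \<Rightarrow> (nat \<Rightarrow> 'a set) \<Rightarrow> (nat \<Rightarrow> 'a set) \<Rightarrow> 'a set" where
  "lex_cone G k F C =
     {g \<in> carrier G. \<exists>c. normal_form G k F g c \<and>
        (\<exists>j\<in>{1..k}. c j \<in> C j \<and> (\<forall>i\<in>{1..k}. i > j \<longrightarrow> c i = \<one>\<^bsub>G\<^esub>))}"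


section \<open>Existence and uniqueness of the Magnus map\<close>

lemma nc_series_ring_simps [simp]:
  "carrier (nc_series_ring n) = {f. \<forall>w. f w \<noteq> 0 \<longrightarrow> set w \<subseteq> {1..n}}"
  "f \<otimes>\<^bsub>nc_series_ring n\<^esub> g = (\<lambda>w. \<Sum>i\<le>length w. f (take i w) * g (drop i w))"
  "\<one>\<^bsub>nc_series_ring n\<^esub> = (\<lambda>w. if w = [] then 1 else 0)"
  "\<zero>\<^bsub>nc_series_ring n\<^esub> = (\<lambda>w. 0)"
  "f \<oplus>\<^bsub>nc_series_ring n\<^esub> g = (\<lambda>w. f w + g w)"
  by (simp_all add: nc_series_ring_def)

lemma nc_mult_assoc:
  fixes f g h :: "nat list \<Rightarrow> int"
  shows "(\<Sum>i\<le>length w. (\<Sum>j\<le>length (take i w). f (take j (take i w)) * g (drop j (take i w)))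
            * h (drop i w)) =
         (\<Sum>j\<le>length w. f (take j w) *
            (\<Sum>i\<le>length (drop j w). g (take i (drop j w)) * h (drop i (drop j w))))"
    (is "?L = ?R")
proof -
  let ?t = "\<lambda>j i. f (take j w) * g (take (i - j) (drop j w)) * h (drop i w)"
  have "?L = (\<Sum>i\<le>length w. \<Sum>j\<le>i. ?t j i)"
    by (intro sum.cong refl) (simp add: sum_distrib_right drop_take min_def)
  also have "\<dots> = (\<Sum>(i, j) \<in> (SIGMA i:{..length w}. {..i}). ?t j i)"
    by (simp add: sum.Sigma)
  also have "\<dots> = (\<Sum>(j, m) \<in> (SIGMA j:{..length w}. {..length w - j}). ?t j (j + m))"
    by (rule sum.reindex_bij_witness
          [where i = "\<lambda>(j, m). (j + m, j)" and j = "\<lambda>(i, j). (j, i - j)"]) auto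
  also have "\<dots> = (\<Sum>j\<le>length w. \<Sum>m\<le>length w - j. ?t j (j + m))"
    by (simp add: sum.Sigma)
  also have "\<dots> = ?R"
    by (intro sum.cong refl) (simp add: sum_distrib_left mult.assoc add.commute)
  finally show ?thesis .
qed

lemma sum_atMost_single:
  fixes F :: "nat \<Rightarrow> int"
  assumes "m \<le> l" "\<And>i. i \<le> l \<Longrightarrow> i \<noteq> m \<Longrightarrow> F i = 0"
  shows "(\<Sum>i\<le>l. F i) = F m"
proof -
  have "(\<Sum>i\<le>l. F i) = (\<Sum>i\<in>{m}. F i)"
    using assms by (intro sum.mono_neutral_right) auto
  then show ?thesis by simp
qed

lemma nc_one_left:
  fixes f :: "nat list \<Rightarrow> int"
  shows "(\<Sum>i\<le>length w. (if take i w = [] then 1 else 0) * f (drop i w)) = f w"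
  by (subst sum_atMost_single[where m = 0]) auto

lemma nc_one_right:
  fixes f :: "nat list \<Rightarrow> int"
  shows "(\<Sum>i\<le>length w. f (take i w) * (if drop i w = [] then 1 else 0)) = f w"
  by (subst sum_atMost_single[where m = "length w"]) auto

lemma nc_mult_supp:
  fixes f g :: "nat list \<Rightarrow> int"
  assumes "\<forall>w. f w \<noteq> 0 \<longrightarrow> set w \<subseteq> S" "\<forall>w. g w \<noteq> 0 \<longrightarrow> set w \<subseteq> S"
    and "(\<Sum>i\<le>length w. f (take i w) * g (drop i w)) \<noteq> 0"
  shows "set w \<subseteq> S"
proof -
  obtain i where "f (take i w) * g (drop i w) \<noteq> 0"
    using sum.not_neutral_contains_not_neutral[OF assms(3)] by blast
  then have "f (take i w) \<noteq> 0" "g (drop i w) \<noteq> 0"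
    by simp_all
  then have "set (take i w) \<subseteq> S" "set (drop i w) \<subseteq> S"
    using assms(1,2) by blast+
  then show ?thesis
    by (metis Un_subset_iff append_take_drop_id set_append)
qed

lemma nc_series_ring: "ring (nc_series_ring n)"
proof (rule ringI)
  show "abelian_group (nc_series_ring n)"
  proof (rule abelian_groupI)
    fix f assume f: "f \<in> carrier (nc_series_ring n)"
    show "\<exists>g\<in>carrier (nc_series_ring n). g \<oplus>\<^bsub>nc_series_ring n\<^esub> f = \<zero>\<^bsub>nc_series_ring n\<^esub>"
      by (rule bexI[where x = "\<lambda>w. - f w"]) (use f in auto)
  next
    fix f g assume "f \<in> carrier (nc_series_ring n)" "g \<in> carrier (nc_series_ring n)"
    then show "f \<oplus>\<^bsub>nc_series_ring n\<^esub> g \<in> carrier (nc_series_ring n)"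
      by simp (metis add_0)
  qed (auto simp: algebra_simps)
  show "Group.monoid (nc_series_ring n)"
  proof
    fix f g assume "f \<in> carrier (nc_series_ring n)" "g \<in> carrier (nc_series_ring n)"
    then show "f \<otimes>\<^bsub>nc_series_ring n\<^esub> g \<in> carrier (nc_series_ring n)"
      using nc_mult_supp[of f "{1..n}" g] by (simp only: nc_series_ring_simps) blast
  qed (simp_all only: nc_series_ring_simps nc_mult_assoc nc_one_left nc_one_right, auto)
qed (auto simp: algebra_simps sum.distrib)

lemma nc_one_plus_var_unit:
  assumes "i \<in> {1..n}"
  shows "\<one>\<^bsub>nc_series_ring n\<^esub> \<oplus>\<^bsub>nc_series_ring n\<^esub> nc_var i \<in> Units (nc_series_ring n)"
proof -
  define u :: "nat list \<Rightarrow> int" where "u = (\<lambda>w. (if w = [] then 1 else 0) + nc_var i w)"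
  define s :: "nat list \<Rightarrow> int" where "s = (\<lambda>w. if set w \<subseteq> {i} then (-1) ^ length w else 0)"
  have us: "(\<Sum>j\<le>length w. u (take j w) * s (drop j w)) = (if w = [] then 1 else 0)" for w
  proof (cases w)
    case (Cons a v)
    have "(\<Sum>j\<le>length w. u (take j w) * s (drop j w)) =
            s (a # v) + (\<Sum>j\<le>length v. u (a # take j v) * s (drop j v))"
      by (simp add: Cons sum.atMost_Suc_shift u_def nc_var_def del: sum.atMost_Suc)
    also have "(\<Sum>j\<le>length v. u (a # take j v) * s (drop j v)) = u [a] * s v"
      by (subst sum_atMost_single[where m = 0]) (auto simp: u_def nc_var_def)
    finally show ?thesis
      by (auto simp: Cons u_def nc_var_def s_def)
  qed (simp add: u_def s_def nc_var_def)
  have su: "(\<Sum>j\<le>length w. s (take j w) * u (drop j w)) = (if w = [] then 1 else 0)" for w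
  proof (cases w rule: rev_cases)
    case (snoc v a)
    have "(\<Sum>j\<le>length w. s (take j w) * u (drop j w)) =
            (\<Sum>j\<le>length v. s (take j v) * u (drop j v @ [a])) + s (v @ [a])"
      by (simp add: snoc u_def nc_var_def)
    also have "(\<Sum>j\<le>length v. s (take j v) * u (drop j v @ [a])) = s v * u [a]"
      by (subst sum_atMost_single[where m = "length v"]) (auto simp: u_def nc_var_def)
    finally show ?thesis
      by (auto simp: snoc u_def nc_var_def s_def)
  qed (simp add: u_def s_def nc_var_def)
  have "u \<in> carrier (nc_series_ring n)" "s \<in> carrier (nc_series_ring n)"
    using assms by (auto simp: u_def s_def nc_var_def split: if_splits)
  moreover have "u \<otimes>\<^bsub>nc_series_ring n\<^esub> s = \<one>\<^bsub>nc_series_ring n\<^esub>"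
    "s \<otimes>\<^bsub>nc_series_ring n\<^esub> u = \<one>\<^bsub>nc_series_ring n\<^esub>"
    by (simp_all only: nc_series_ring_simps us su)
  ultimately have "u \<in> Units (nc_series_ring n)"
    unfolding Units_def by blast
  then show ?thesis by (simp add: u_def)
qed

lemma word_eval_Nil [simp]: "word_eval H x [] = \<one>\<^bsub>H\<^esub>"
  by (simp add: word_eval_def)

lemma word_eval_Cons: "word_eval H x (a # w) = letter_eval H x a \<otimes>\<^bsub>H\<^esub> word_eval H x w"
  by (simp add: word_eval_def)

lemma (in group) letter_eval_closed:
  assumes "x \<in> {1..n} \<rightarrow> carrier G" "fst a \<in> {1..n}"
  shows "letter_eval G x a \<in> carrier G"
  using assms by (cases a) (auto simp: Pi_iff)

lemma (in group) word_eval_closed: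
  assumes "x \<in> {1..n} \<rightarrow> carrier G" "fst ` set w \<subseteq> {1..n}"
  shows "word_eval G x w \<in> carrier G"
  using assms(2)
  by (induction w) (auto simp del: letter_eval.simps simp: word_eval_Cons intro!: letter_eval_closed[OF assms(1)])

lemma (in group) word_eval_append:
  assumes "x \<in> {1..n} \<rightarrow> carrier G" "fst ` set v \<subseteq> {1..n}" "fst ` set w \<subseteq> {1..n}"
  shows "word_eval G x (v @ w) = word_eval G x v \<otimes> word_eval G x w"
  using assms(2)
proof (induction v)
  case (Cons a v)
  have "letter_eval G x a \<in> carrier G"
    using Cons.prems by (intro letter_eval_closed[OF assms(1)]) auto
  then show ?case
    using Cons word_eval_closed[OF assms(1)] assms(3) by (simp add: word_eval_Cons m_assoc)
qed (simp add: word_eval_closed[OF assms(1,3)])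

lemma (in group) letter_eval_cancel:
  assumes "x \<in> {1..n} \<rightarrow> carrier G" "fst a \<in> {1..n}" "fst a = fst b" "snd a \<noteq> snd b"
    and "y \<in> carrier G"
  shows "letter_eval G x a \<otimes> (letter_eval G x b \<otimes> y) = y"
proof -
  obtain i e where a: "a = (i, e)" by (cases a)
  then have b: "b = (i, \<not> e)" using assms(3,4) by (cases b) auto
  have "x i \<in> carrier G" using assms(1,2) a by auto
  then show ?thesis
    using assms(5) by (simp add: a b m_assoc[symmetric])
qed

lemma free_basis_hom_exists:
  assumes "group H" "group K" "free_basis H n x" "y \<in> {1..n} \<rightarrow> carrier K"
  shows "\<exists>f\<in>hom H K. \<forall>i\<in>{1..n}. f (x i) = y i"
proof -
  interpret H: group H by fact
  interpret K: group K by fact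
  define E where "E = word_eval H x"
  define E' where "E' = word_eval K y"
  define f where "f = (\<lambda>g. E' (inv_into (reduced_words n) E g))"
  have x: "x \<in> {1..n} \<rightarrow> carrier H" and bij: "bij_betw E (reduced_words n) (carrier H)"
    using assms(3) by (auto simp: free_basis_def E_def)
  have f_red: "f (E r) = E' r" if "r \<in> reduced_words n" for r
    using bij that by (simp add: f_def bij_betw_def)
  have f_E: "f (E w) = E' w" if "fst ` set w \<subseteq> {1..n}" for w
    using that
  proof (induction w)
    case Nil
    show ?case using f_red[of "[]"] by (simp add: reduced_words_def)
  next
    case (Cons a w)
    have a: "fst a \<in> {1..n}" and w: "fst ` set w \<subseteq> {1..n}" using Cons.prems by auto
    have "E w \<in> carrier H" unfolding E_def by (rule H.word_eval_closed[OF x w])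
    then obtain r where r: "r \<in> reduced_words n" "E w = E r"
      using bij by (auto simp: bij_betw_def)
    have IH: "E' w = E' r" using Cons.IH[OF w] f_red r by simp
    show ?case
    proof (cases "a # r \<in> reduced_words n")
      case True
      have "f (E (a # w)) = f (E (a # r))" using r by (simp add: E_def word_eval_Cons)
      also have "\<dots> = E' (a # w)" using f_red[OF True] IH by (simp add: E'_def word_eval_Cons)
      finally show ?thesis .
    next
      case False
      then obtain b s where b: "r = b # s" "fst a = fst b" "snd a \<noteq> snd b"
        using r(1) a by (cases r) (auto simp: reduced_words_def)
      have s: "s \<in> reduced_words n" "fst ` set s \<subseteq> {1..n}"
        using r(1) unfolding b(1) reduced_words_def by (cases s; auto)+
      have "E (a # w) = E s"
        using r(2) H.letter_eval_cancel[OF x a b(2,3) H.word_eval_closed[OF x s(2)]]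
        by (simp add: E_def word_eval_Cons b(1))
      moreover have "E' (a # w) = E' s"
        using IH K.letter_eval_cancel[OF assms(4) a b(2,3) K.word_eval_closed[OF assms(4) s(2)]]
        by (simp add: E'_def word_eval_Cons b(1))
      ultimately show ?thesis using f_red[OF s(1)] by simp
    qed
  qed
  have surj: "\<exists>w. fst ` set w \<subseteq> {1..n} \<and> g = E w" if "g \<in> carrier H" for g
  proof -
    obtain w where "w \<in> reduced_words n" "g = E w"
      using bij \<open>g \<in> carrier H\<close> by (auto simp: bij_betw_def)
    then show ?thesis by (auto simp: reduced_words_def)
  qed
  have "f \<in> hom H K"
  proof (rule homI)
    fix g assume "g \<in> carrier H"
    then show "f g \<in> carrier K"
      using surj[of g] f_E K.word_eval_closed[OF assms(4)] by (auto simp: E'_def)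
  next
    fix g h assume "g \<in> carrier H" "h \<in> carrier H"
    then obtain v w where v: "fst ` set v \<subseteq> {1..n}" "g = E v"
      and w: "fst ` set w \<subseteq> {1..n}" "h = E w"
      using surj by meson
    have "g \<otimes>\<^bsub>H\<^esub> h = E (v @ w)"
      using H.word_eval_append[OF x v(1) w(1)] v w by (simp add: E_def)
    moreover have "fst ` set (v @ w) \<subseteq> {1..n}" using v w by auto
    ultimately show "f (g \<otimes>\<^bsub>H\<^esub> h) = f g \<otimes>\<^bsub>K\<^esub> f h"
      using f_E[of "v @ w"] f_E[OF v(1)] f_E[OF w(1)] K.word_eval_append[OF assms(4) v(1) w(1)] v w
      by (simp add: E'_def)
  qed
  moreover have "f (x i) = y i" if "i \<in> {1..n}" for i
  proof -
    have "x i \<in> carrier H" "y i \<in> carrier K" using that x assms(4) by auto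
    then show ?thesis
      using f_E[of "[(i, True)]"] that by (simp add: E_def E'_def word_eval_Cons)
  qed
  ultimately show ?thesis by blast
qed

lemma hom_word_eval:
  assumes "group H" "group K" "x \<in> {1..n} \<rightarrow> carrier H" "f \<in> hom H K" "fst ` set w \<subseteq> {1..n}"
  shows "f (word_eval H x w) = word_eval K (f \<circ> x) w"
proof -
  interpret H: group H by fact
  interpret f: group_hom H K f
    by (intro group_hom.intro group_hom_axioms.intro assms)
  show ?thesis
    using assms(5)
  proof (induction w)
    case (Cons a w)
    obtain i e where a: "a = (i, e)" by (cases a)
    have "x i \<in> carrier H" using Cons.prems assms(3) a by auto
    then have "f (letter_eval H x a) = letter_eval K (f \<circ> x) a"
      "letter_eval H x a \<in> carrier H"
      by (auto simp: a)
    then show ?case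
      using Cons H.word_eval_closed[OF assms(3)]
      by (simp add: word_eval_Cons del: letter_eval.simps o_apply)
  qed simp
qed

lemma word_eval_cong:
  assumes "\<And>i. i \<in> {1..n} \<Longrightarrow> x i = y i" "fst ` set w \<subseteq> {1..n}"
  shows "word_eval H x w = word_eval H y w"
  using assms(2)
proof (induction w)
  case (Cons a w)
  then have "letter_eval H x a = letter_eval H y a"
    using assms(1) by (cases a) auto
  then show ?case using Cons by (simp add: word_eval_Cons)
qed simp

lemma ex1_magnus_map:
  assumes "group H" "free_basis H n x"
  shows "\<exists>!\<mu>. is_magnus_map H n x \<mu>"
proof (rule ex_ex1I)
  interpret R: ring "nc_series_ring n" by (rule nc_series_ring)
  let ?U = "units_of (nc_series_ring n)"
  let ?y = "\<lambda>i. \<one>\<^bsub>nc_series_ring n\<^esub> \<oplus>\<^bsub>nc_series_ring n\<^esub> nc_var i"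
  have U: "group ?U" by (rule R.units_group)
  have x: "x \<in> {1..n} \<rightarrow> carrier H" using assms(2) by (simp add: free_basis_def)
  have "?y \<in> {1..n} \<rightarrow> carrier ?U"
    using nc_one_plus_var_unit by (auto simp only: units_of_carrier Pi_iff)
  then obtain f where f: "f \<in> hom H ?U" "\<forall>i\<in>{1..n}. f (x i) = ?y i"
    using free_basis_hom_exists[OF assms(1) U assms(2)] by blast
  interpret H: group H by fact
  have "restrict f (carrier H) \<in> hom H ?U"
    using f(1) by (auto simp: hom_def Pi_iff)
  then have "is_magnus_map H n x (restrict f (carrier H))"
    using f(2) x unfolding is_magnus_map_def by (auto simp: Pi_iff)
  then show "\<exists>\<mu>. is_magnus_map H n x \<mu>" by blast
next
  interpret R: ring "nc_series_ring n" by (rule nc_series_ring)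
  let ?U = "units_of (nc_series_ring n)"
  have U: "group ?U" by (rule R.units_group)
  have x: "x \<in> {1..n} \<rightarrow> carrier H" using assms(2) by (simp add: free_basis_def)
  fix \<mu> \<nu> assume *: "is_magnus_map H n x \<mu>" "is_magnus_map H n x \<nu>"
  show "\<mu> = \<nu>"
  proof (rule extensionalityI[where A = "carrier H"])
    fix g assume "g \<in> carrier H"
    then obtain w where w: "w \<in> reduced_words n" "g = word_eval H x w"
      using assms(2) by (auto simp: free_basis_def bij_betw_def)
    have w': "fst ` set w \<subseteq> {1..n}" using w(1) by (simp add: reduced_words_def)
    have "\<mu> g = word_eval ?U (\<mu> \<circ> x) w"
      using hom_word_eval[OF assms(1) U x _ w'] * w by (auto simp: is_magnus_map_def)
    also have "\<dots> = word_eval ?U (\<nu> \<circ> x) w"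
      by (rule word_eval_cong[OF _ w']) (use * in \<open>auto simp: is_magnus_map_def\<close>)
    also have "\<dots> = \<nu> g"
      using hom_word_eval[OF assms(1) U x _ w'] * w by (auto simp: is_magnus_map_def)
    finally show "\<mu> g = \<nu> g" .
  qed (use * in \<open>auto simp: is_magnus_map_def\<close>)
qed

corollary magnus_is_magnus_map:
  assumes "group H" "free_basis H n x"
  shows "is_magnus_map H n x (magnus H n x)"
  unfolding magnus_def by (rule theI'[OF ex1_magnus_map[OF assms]])

end

theory Submission
  imports Defs "HOL-Library.Sublist"
begin

text \<open>
  Applied to each factor of a normal form, \<open>\<phi>\<close> yields a normal form, so \<open>\<phi>(P) \<subseteq> P\<close> is immediate.
  For the converse, a preimage of a positive element must be positive; this holds because each
  Magnus-type ordering is total. Totality amounts to the injectivity of the Magnus map: the image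
  of a reduced word with syllables \<open>x\<^sub>a^p, x\<^sub>b^q, \<dots>\<close> has the coefficient \<open>p q \<cdots> \<noteq> 0\<close> at the
  monomial \<open>X\<^sub>a X\<^sub>b \<cdots>\<close>.
\<close>

section \<open>Faithfulness of the Magnus map\<close>

text \<open>As \<open>1 + X_i\<close> lives in degrees 0 and 1, only the factorizations with an
  empty or one-letter prefix contribute. The case split on the first letter makes this a recursion
  usable along words.\<close>

lemma one_plus_nc_var_mult:
  "(\<one>\<^bsub>nc_series_ring n\<^esub> \<oplus>\<^bsub>nc_series_ring n\<^esub> nc_var i) \<otimes>\<^bsub>nc_series_ring n\<^esub> f =
     (\<lambda>w. f w + (case w of [] \<Rightarrow> 0 | j # v \<Rightarrow> if j = i then f v else 0))"
proof
  fix w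
  show "((\<one>\<^bsub>nc_series_ring n\<^esub> \<oplus>\<^bsub>nc_series_ring n\<^esub> nc_var i) \<otimes>\<^bsub>nc_series_ring n\<^esub> f) w =
     f w + (case w of [] \<Rightarrow> 0 | j # v \<Rightarrow> if j = i then f v else 0)"
  proof (cases w)
    case (Cons j v)
    let ?u = "\<lambda>w. (if w = [] then 1 else 0) + nc_var i w"
    have "(\<Sum>l\<le>length v. ?u (j # take l v) * f (drop l v)) = ?u [j] * f v"
      by (subst sum_atMost_single[where m = 0]) (auto simp: nc_var_def)
    then show ?thesis
      by (simp add: Cons sum.atMost_Suc_shift nc_var_def del: sum.atMost_Suc)
  qed (simp add: nc_var_def)
qed

lemma magnus_mult:
  assumes "group H" "free_basis H n x" "g \<in> carrier H" "h \<in> carrier H"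
  shows "magnus H n x (g \<otimes>\<^bsub>H\<^esub> h) =
           magnus H n x g \<otimes>\<^bsub>nc_series_ring n\<^esub> magnus H n x h"
proof -
  have "magnus H n x \<in> hom H (units_of (nc_series_ring n))"
    using magnus_is_magnus_map[OF assms(1,2)] by (simp only: is_magnus_map_def)
  from hom_mult[OF this assms(3,4)] show ?thesis by (simp only: units_of_mult)
qed

lemma magnus_one:
  assumes "group H" "free_basis H n x"
  shows "magnus H n x \<one>\<^bsub>H\<^esub> = \<one>\<^bsub>nc_series_ring n\<^esub>"
proof -
  interpret R: ring "nc_series_ring n" by (rule nc_series_ring)
  have "magnus H n x \<in> hom H (units_of (nc_series_ring n))"
    using magnus_is_magnus_map[OF assms] by (simp only: is_magnus_map_def)
  then have "magnus H n x \<one>\<^bsub>H\<^esub> = \<one>\<^bsub>units_of (nc_series_ring n)\<^esub>"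
    by (rule hom_one[OF _ assms(1) R.units_group])
  then show ?thesis by (simp only: units_of_one)
qed

lemma magnus_basis_mult:
  assumes "group H" "free_basis H n x" "i \<in> {1..n}" "g \<in> carrier H"
  shows "magnus H n x (x i \<otimes>\<^bsub>H\<^esub> g) w =
    magnus H n x g w + (case w of [] \<Rightarrow> 0 | j # v \<Rightarrow> if j = i then magnus H n x g v else 0)"
proof -
  have "x i \<in> carrier H"
    using assms(2,3) by (auto simp: free_basis_def)
  moreover have "magnus H n x (x i) = \<one>\<^bsub>nc_series_ring n\<^esub> \<oplus>\<^bsub>nc_series_ring n\<^esub> nc_var i"
    using magnus_is_magnus_map[OF assms(1,2)] assms(3) by (simp only: is_magnus_map_def)
  ultimately show ?thesis
    by (simp only: magnus_mult[OF assms(1,2) _ assms(4)] one_plus_nc_var_mult)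
qed

text \<open>
  On monomials without adjacent repetitions, \<open>(1 + X\<^sub>i)\<^sup>-\<^sup>1 = 1 - X\<^sub>i + X\<^sub>i\<^sup>2 - \<cdots>\<close> acts like \<open>1 - X\<^sub>i\<close>.
\<close>

lemma magnus_letter_mult:
  assumes H: "group H" and x: "free_basis H n x" and i: "fst a \<in> {1..n}" and g: "g \<in> carrier H"
    and w: "distinct_adj w"
  shows "magnus H n x (letter_eval H x a \<otimes>\<^bsub>H\<^esub> g) w =
    magnus H n x g w + (case w of [] \<Rightarrow> 0 | j # v \<Rightarrow>
      if j = fst a then (if snd a then 1 else -1) * magnus H n x g v else 0)"
proof (cases a)
  case (Pair i e)
  interpret H: group H by fact
  have i': "i \<in> {1..n}" using i Pair by simp
  have xi: "x i \<in> carrier H" using x i' by (auto simp: free_basis_def)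
  show ?thesis
  proof (cases e)
    case True
    then show ?thesis
      using magnus_basis_mult[OF H x i' g, of w] by (simp add: Pair split: list.splits)
  next
    case False
    define h where "h = inv\<^bsub>H\<^esub> (x i) \<otimes>\<^bsub>H\<^esub> g"
    have h: "h \<in> carrier H" "x i \<otimes>\<^bsub>H\<^esub> h = g"
      using xi g by (simp_all add: h_def H.m_assoc[symmetric])
    \<comment> \<open>The rule for \<open>1 + X_i\<close> is read backwards: from
      \<open>x i * h = g\<close> it expresses coefficients of \<open>g\<close> through those of
      \<open>h\<close>, and has to be solved for \<open>h\<close>.\<close>
    note step = magnus_basis_mult[OF H x i' h(1), unfolded h(2)]
    show ?thesis
    proof (cases w)
      case Nil
      then show ?thesis using step[of "[]"] by (simp add: Pair False h_def)
    next
      case (Cons j v)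
      \<comment> \<open>As \<open>i # v\<close> has no adjacent repetition, \<open>v\<close> does
        not begin with \<open>i\<close>. The correction term at \<open>v\<close> therefore vanishes,
        and the recursion for the inverse stops after one step.\<close>
      have "magnus H n x g v = magnus H n x h v" if "j = i"
        using step[of v] w Cons that by (cases v) auto
      then show ?thesis using step[of w] by (auto simp: Cons Pair False h_def)
    qed
  qed
qed

section \<open>Support and syllable coefficient on repetition-free monomials\<close>

text \<open>The critical case is a condensed word already starting with \<open>i\<close>, where
  prefixing \<open>i\<close> creates no new syllable. There \<open>v\<close> does not start with
  \<open>i\<close>, so it embeds in the tail and leaves the head free to match
  \<open>i\<close>.\<close>

lemma subseq_remdups_adj_Cons:
  assumes "distinct_adj (i # v)" "subseq v (remdups_adj ws)"
  shows "subseq (i # v) (remdups_adj (i # ws))"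
proof (cases "remdups_adj ws")
  case (Cons j u)
  have ra: "remdups_adj (i # ws) = (if i = j then j # u else i # j # u)"
    using Cons by (cases ws) (auto simp: remdups_adj_Cons)
  show ?thesis
  proof (cases "i = j")
    case True
    have "subseq v u"
      using assms Cons True by (cases v) auto
    then show ?thesis using ra True by simp
  qed (use assms Cons ra in simp)
qed (use assms in simp)

lemma subseq_remdups_adj_mono: "subseq (remdups_adj ws) (remdups_adj (i # ws))"
  by (cases "remdups_adj ws") (auto simp: remdups_adj_Cons)

text \<open>Prefixing a letter with index \<open>i\<close> only adds to the coefficient at
  \<open>i # t\<close> a multiple of the one at \<open>t\<close>. The point is a length bound: a
  repetition-free monomial with more letters than the word has syllables gets coefficient 0.\<close>

lemma magnus_supp_subseq:
  assumes H: "group H" and x: "free_basis H n x"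
    and "fst ` set w \<subseteq> {1..n}" "distinct_adj v" "magnus H n x (word_eval H x w) v \<noteq> 0"
  shows "subseq v (remdups_adj (map fst w))"
  using assms(3-)
proof (induction w arbitrary: v)
  case Nil
  then show ?case
    using magnus_one[OF H x] by (simp split: if_splits)
next
  case (Cons a w)
  have a: "fst a \<in> {1..n}" and w: "fst ` set w \<subseteq> {1..n}" using Cons.prems by auto
  have e: "word_eval H x w \<in> carrier H"
    using group.word_eval_closed[OF H _ w] x by (simp add: free_basis_def)
  let ?c = "magnus H n x (word_eval H x w)"
  \<comment> \<open>A nonzero sum has a nonzero summand: either the old coefficient at
    \<open>v\<close> or the contribution of its tail.\<close>
  consider "?c v \<noteq> 0" | t where "v = fst a # t" "?c t \<noteq> 0"
    using Cons.prems(3) unfolding word_eval_Cons magnus_letter_mult[OF H x a e Cons.prems(2)]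
    by (cases v) (fastforce split: if_splits)+
  then show ?case
  proof cases
    case 1
    then show ?thesis
      using Cons.IH[OF w Cons.prems(2)] subseq_remdups_adj_mono[of "map fst w" "fst a"]
      by (auto intro: subseq_order.trans)
  next
    case 2
    have "distinct_adj t" using Cons.prems(2) 2(1) by (cases t) auto
    then show ?thesis
      using subseq_remdups_adj_Cons[of "fst a" t] Cons.IH[OF w _ 2(2)] Cons.prems(2) 2(1) by simp
  qed
qed

text \<open>
  Prolonging the first syllable by one letter adds \<open>\<plusminus>c(t)\<close> to the coefficient \<open>c(i # t)\<close>;
  carrying the sign through the induction rules out cancellation.
\<close>

lemma magnus_syllable_coeff:
  assumes H: "group H" and x: "free_basis H n x"
    and "a # w \<in> reduced_words n"
  shows "(if snd a then 1 else -1) *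
      magnus H n x (word_eval H x (a # w)) (remdups_adj (map fst (a # w))) *
      magnus H n x (word_eval H x (a # w)) (tl (remdups_adj (map fst (a # w)))) > 0"
  using assms(3)
proof (induction w arbitrary: a)
  case Nil
  then have a: "fst a \<in> {1..n}" by (auto simp: reduced_words_def)
  interpret H: group H by fact
  have "magnus H n x (word_eval H x [a]) v =
      (if v = [] then 1 else if v = [fst a] then if snd a then 1 else -1 else 0)"
    if "distinct_adj v" for v
    using magnus_letter_mult[OF H x a H.one_closed that] magnus_one[OF H x]
    by (auto simp: word_eval_Cons split: list.splits)
  then show ?case by simp
next
  case (Cons b w)
  have a: "fst a \<in> {1..n}" and bw: "b # w \<in> reduced_words n" "fst ` set (b # w) \<subseteq> {1..n}"
    and ab: "fst a = fst b \<Longrightarrow> snd a = snd b"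
    using Cons.prems by (auto simp: reduced_words_def)
  have e: "word_eval H x (b # w) \<in> carrier H"
    using group.word_eval_closed[OF H _ bw(2)] x by (simp add: free_basis_def)
  define c where "c = magnus H n x (word_eval H x (b # w))"
  define D where "D = remdups_adj (map fst (b # w))"
  obtain t where D: "D = fst b # t"
    by (metis D_def hd_map hd_remdups_adj list.distinct(1) list.exhaust_sel list.map_disc_iff
        list.sel(1) remdups_adj_Nil_iff)
  have dD: "distinct_adj D" by (simp add: D_def del: list.map)
  then have dt: "distinct_adj t" using D by (cases t) auto
  have IH: "(if snd b then 1 else -1) * c D * c t > 0"
    using Cons.IH[OF bw(1)] D unfolding c_def D_def by simp
  have step: "magnus H n x (word_eval H x (a # b # w)) v =
      c v + (case v of [] \<Rightarrow> 0 | j # u \<Rightarrow>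
        if j = fst a then (if snd a then 1 else -1) * c u else 0)" if "distinct_adj v" for v
    using magnus_letter_mult[OF H x a e that] by (simp only: word_eval_Cons[of H x a] c_def)
  show ?case
  proof (cases "fst a = fst b")
    case True
    have Da: "remdups_adj (map fst (a # b # w)) = D"
      using True by (simp add: D_def)
    have "magnus H n x (word_eval H x (a # b # w)) D = c D + (if snd b then 1 else -1) * c t"
      using step[OF dD] D True ab by simp
    moreover have "magnus H n x (word_eval H x (a # b # w)) t = c t"
      using step[OF dt] dD D True by (cases t) auto
    \<comment> \<open>Both letters carry the same sign, so the new signed product is the old one
      plus \<open>c t * c t\<close>; two positive terms cannot cancel.\<close>
    moreover have "c t * c t > 0" using IH
      by (metis mult_zero_right not_real_square_gt_zero less_irrefl zero_less_mult_iff linorder_neqE)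
    ultimately show ?thesis
      using IH ab True unfolding Da D by (auto simp: algebra_simps split: if_splits)
  next
    case False
    have Da: "remdups_adj (map fst (a # b # w)) = fst a # D"
      using False by (simp add: D_def)
    have da: "distinct_adj (fst a # D)" using dD D False by simp
    \<comment> \<open>A new syllable opens. The monomial \<open>fst a # D\<close> is longer than
      \<open>D\<close>, so the support bound excludes any earlier contribution; the signed product
      becomes \<open>c D * c D\<close>.\<close>
    have "c (fst a # D) = 0"
    proof (rule ccontr)
      assume "c (fst a # D) \<noteq> 0"
      then have "subseq (fst a # D) D"
        using magnus_supp_subseq[OF H x bw(2) da] by (simp add: c_def D_def)
      then show False using list_emb_length by fastforce
    qed
    then have "magnus H n x (word_eval H x (a # b # w)) (fst a # D) = (if snd a then 1 else -1) * c D"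
      using step[OF da] by simp
    moreover have "magnus H n x (word_eval H x (a # b # w)) D = c D"
      using step[OF dD] D False by simp
    moreover have "c D \<noteq> 0" using IH by auto
    ultimately show ?thesis
      unfolding Da by (auto simp: zero_less_mult_iff)
  qed
qed

section \<open>Injectivity and the constant term\<close>

text \<open>For a nonempty reduced word, positivity in \<open>magnus_syllable_coeff\<close> forces a
  nonzero coefficient at its syllable monomial. That monomial is nonempty, where the series 1 has
  coefficient 0.\<close>

lemma magnus_eq_one_iff:
  assumes "group H" "free_basis H n x" "g \<in> carrier H"
  shows "magnus H n x g = \<one>\<^bsub>nc_series_ring n\<^esub> \<longleftrightarrow> g = \<one>\<^bsub>H\<^esub>"
proof
  assume 1: "magnus H n x g = \<one>\<^bsub>nc_series_ring n\<^esub>"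
  obtain w where w: "w \<in> reduced_words n" "g = word_eval H x w"
    using assms(2,3) by (auto simp: free_basis_def bij_betw_def)
  show "g = \<one>\<^bsub>H\<^esub>"
  proof (cases w)
    case (Cons a v)
    have "remdups_adj (map fst w) \<noteq> []" by (simp add: Cons del: remdups_adj.simps)
    then have "magnus H n x g (remdups_adj (map fst w)) = 0"
      using 1 by simp
    then show ?thesis
      using magnus_syllable_coeff[OF assms(1,2), of a v] w Cons by simp
  qed (use w in simp)
qed (use magnus_one[OF assms(1,2)] in simp)

text \<open>The correction term of \<open>magnus_letter_mult\<close> is 0 at the empty monomial.
  Hence every monomial occurring in \<open>\<mu>(g) - 1\<close> has positive degree.\<close>

lemma magnus_Nil:
  assumes H: "group H" and x: "free_basis H n x" and "g \<in> carrier H"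
  shows "magnus H n x g [] = 1"
proof -
  obtain w where w: "w \<in> reduced_words n" "g = word_eval H x w"
    using assms(2,3) by (auto simp: free_basis_def bij_betw_def)
  have "magnus H n x (word_eval H x w) [] = 1" if "fst ` set w \<subseteq> {1..n}" for w
    using that
  proof (induction w)
    case (Cons a w)
    have "fst a \<in> {1..n}" "word_eval H x w \<in> carrier H"
      using group.word_eval_closed[OF H, of x n w] x Cons.prems by (auto simp: free_basis_def)
    then show ?case
      using magnus_letter_mult[OF H x, of a "word_eval H x w" "[]"] Cons by (simp add: word_eval_Cons)
  qed (simp add: magnus_one[OF H x])
  then show ?thesis using w by (simp add: reduced_words_def)
qed

section \<open>Totality of the Magnus-type ordering\<close>

lemma magnus_cone_iff:
  "g \<in> magnus_cone H n x \<longleftrightarrow> g \<in> carrier H \<and> g \<noteq> \<one>\<^bsub>H\<^esub> \<and>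
     (\<exists>w. magnus H n x g w - (if w = [] then 1 else 0) > 0 \<and>
        (\<forall>v. (v, w) \<in> lenlex less_than \<longrightarrow> magnus H n x g v = (if v = [] then 1 else 0)))"
proof -
  interpret R: ring "nc_series_ring n" by (rule nc_series_ring)
  have "\<ominus>\<^bsub>nc_series_ring n\<^esub> \<one>\<^bsub>nc_series_ring n\<^esub> = (\<lambda>w. if w = [] then -1 else 0)"
    by (rule R.minus_equality) auto
  then have "f \<ominus>\<^bsub>nc_series_ring n\<^esub> \<one>\<^bsub>nc_series_ring n\<^esub> = (\<lambda>w. f w - (if w = [] then 1 else 0))" for f
    by (auto simp: a_minus_def)
  then show ?thesis
    by (auto simp: magnus_cone_def Let_def)
qed

lemma lenlex_less_than_linear:
  "(v, w) \<in> lenlex less_than \<or> v = w \<or> (w, v) \<in> lenlex less_than"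
  using total_lenlex[OF total_less_than] by (auto simp: total_on_def)

section \<open>Leading coefficients of inverses\<close>

text \<open>If \<open>f\<close> is \<open>1 + c w\<close> plus larger terms, its inverse begins with
  \<open>1 - c w\<close>. A proper nonempty prefix of a monomial up to \<open>w\<close> has smaller
  degree than \<open>w\<close>, so only the two trivial factorizations survive in the
  product.\<close>

lemma nc_inverse_leading_coeff:
  fixes f h :: "nat list \<Rightarrow> int"
  assumes inv: "f \<otimes>\<^bsub>nc_series_ring n\<^esub> h = \<one>\<^bsub>nc_series_ring n\<^esub>"
    and 1: "f [] = 1" "h [] = 1" and "w \<noteq> []"
    and low: "\<And>v. (v, w) \<in> lenlex less_than \<Longrightarrow> v \<noteq> [] \<Longrightarrow> f v = 0"
  shows "h w = - f w" "\<And>v. (v, w) \<in> lenlex less_than \<Longrightarrow> v \<noteq> [] \<Longrightarrow> h v = 0"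
proof -
  have *: "h v = - f v"
    if "v \<noteq> []" and v: "v = w \<or> (v, w) \<in> lenlex less_than" for v
  proof -
    have short: "f (take i v) = 0" if "0 < i" "i < length v" for i
    proof -
      \<comment> \<open>Degree is compared first, so a strictly shorter prefix precedes
        \<open>w\<close> whatever its letters are.\<close>
      have "length v \<le> length w" using v by (auto simp: lenlex_conv)
      then have "(take i v, w) \<in> lenlex less_than" using that by (simp add: lenlex_conv)
      then show ?thesis using low that by fastforce
    qed
    have "0 = (\<Sum>i\<le>length v. f (take i v) * h (drop i v))"
      using fun_cong[OF inv, of v] \<open>v \<noteq> []\<close> by simp
    also have "\<dots> = (\<Sum>i\<in>{0, length v}. f (take i v) * h (drop i v))"
    proof (rule sum.mono_neutral_right)
      show "\<forall>i\<in>{..length v} - {0, length v}. f (take i v) * h (drop i v) = 0"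
        using short by auto
    qed auto
    also have "\<dots> = h v + f v"
      using \<open>v \<noteq> []\<close> by (simp add: 1)
    finally show ?thesis by simp
  qed
  show "h w = - f w" using * \<open>w \<noteq> []\<close> by blast
  show "h v = 0" if "(v, w) \<in> lenlex less_than" "v \<noteq> []" for v
    using * low that by fastforce
qed

context
  fixes H :: "('a, 'b) monoid_scheme" and n x
  assumes H: "group H" and x: "free_basis H n x"
begin

lemma magnus_inv_leading_coeff:
  assumes g: "g \<in> carrier H" and "w \<noteq> []"
    and low: "\<And>v. (v, w) \<in> lenlex less_than \<Longrightarrow> magnus H n x g v = (if v = [] then 1 else 0)"
  shows "magnus H n x (inv\<^bsub>H\<^esub> g) w = - magnus H n x g w"
    "\<And>v. (v, w) \<in> lenlex less_than \<Longrightarrow> magnus H n x (inv\<^bsub>H\<^esub> g) v = (if v = [] then 1 else 0)"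
proof -
  interpret H: group H by (rule H)
  have g': "inv\<^bsub>H\<^esub> g \<in> carrier H" using g by simp
  have inv: "magnus H n x g \<otimes>\<^bsub>nc_series_ring n\<^esub> magnus H n x (inv\<^bsub>H\<^esub> g) = \<one>\<^bsub>nc_series_ring n\<^esub>"
    using magnus_mult[OF H x g g'] magnus_one[OF H x] H.r_inv[OF g] by simp
  note 1 = magnus_Nil[OF H x g] magnus_Nil[OF H x g']
  note lc = nc_inverse_leading_coeff[OF inv 1 \<open>w \<noteq> []\<close>]
  show "magnus H n x (inv\<^bsub>H\<^esub> g) w = - magnus H n x g w"
    using lc(1) low by simp
  show "magnus H n x (inv\<^bsub>H\<^esub> g) v = (if v = [] then 1 else 0)"
    if "(v, w) \<in> lenlex less_than" for v
    using lc(2)[OF _ that] low 1 by simp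
qed

section \<open>Trichotomy for the Magnus cone\<close>

text \<open>By faithfulness \<open>\<mu>(g) - 1\<close> has nonempty support, and well-foundedness
  of \<open>lenlex\<close> yields a least monomial. Inversion flips the coefficient there and leaves
  smaller ones unchanged, so its sign decides between \<open>g\<close> and its inverse.\<close>

lemma magnus_cone_total:
  assumes g: "g \<in> carrier H" "g \<noteq> \<one>\<^bsub>H\<^esub>"
  shows "g \<in> magnus_cone H n x \<or> inv\<^bsub>H\<^esub> g \<in> magnus_cone H n x"
proof -
  interpret H: group H by (rule H)
  define S where "S = {w. magnus H n x g w \<noteq> (if w = [] then 1 else 0)}"
  have "magnus H n x g \<noteq> \<one>\<^bsub>nc_series_ring n\<^esub>"
    using magnus_eq_one_iff[OF H x g(1)] g(2) by blast
  then have "S \<noteq> {}" by (simp add: S_def fun_eq_iff)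
  then obtain w where w: "w \<in> S" "\<And>v. (v, w) \<in> lenlex less_than \<Longrightarrow> v \<notin> S"
    using wfE_min'[OF wf_lenlex[OF wf_less_than], of S] by metis
  have "w \<noteq> []" using w(1) magnus_Nil[OF H x g(1)] by (auto simp: S_def)
  have low: "magnus H n x g v = (if v = [] then 1 else 0)" if "(v, w) \<in> lenlex less_than" for v
    using w(2)[OF that] by (simp add: S_def)
  consider "magnus H n x g w > 0" | "magnus H n x g w < 0"
    using w(1) \<open>w \<noteq> []\<close> by (fastforce simp: S_def)
  then show ?thesis
  proof cases
    case 1
    then have "g \<in> magnus_cone H n x"
      unfolding magnus_cone_iff using g low \<open>w \<noteq> []\<close> by (intro conjI exI[of _ w] allI impI) simp_all
    then show ?thesis ..
  next
    case 2
    note lc = magnus_inv_leading_coeff[OF g(1) \<open>w \<noteq> []\<close> low]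
    have "inv\<^bsub>H\<^esub> g \<noteq> \<one>\<^bsub>H\<^esub>" using g by (simp add: H.inv_eq_1_iff)
    moreover have "magnus H n x (inv\<^bsub>H\<^esub> g) w > 0" using lc(1) 2 by simp
    ultimately have "inv\<^bsub>H\<^esub> g \<in> magnus_cone H n x"
      unfolding magnus_cone_iff using g lc(2) \<open>w \<noteq> []\<close>
      by (intro conjI exI[of _ w] allI impI) simp_all
    then show ?thesis ..
  qed
qed

lemma magnus_cone_asym:
  assumes "g \<in> magnus_cone H n x"
  shows "inv\<^bsub>H\<^esub> g \<notin> magnus_cone H n x"
proof
  assume "inv\<^bsub>H\<^esub> g \<in> magnus_cone H n x"
  interpret H: group H by (rule H)
  have g: "g \<in> carrier H" using assms by (simp add: magnus_cone_iff)
  obtain w where w: "magnus H n x g w - (if w = [] then 1 else 0) > 0"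
    "\<And>v. (v, w) \<in> lenlex less_than \<Longrightarrow> magnus H n x g v = (if v = [] then 1 else 0)"
    using assms by (auto simp: magnus_cone_iff)
  obtain w' where w': "magnus H n x (inv\<^bsub>H\<^esub> g) w' - (if w' = [] then 1 else 0) > 0"
    "\<And>v. (v, w') \<in> lenlex less_than \<Longrightarrow> magnus H n x (inv\<^bsub>H\<^esub> g) v = (if v = [] then 1 else 0)"
    using \<open>inv\<^bsub>H\<^esub> g \<in> magnus_cone H n x\<close> by (auto simp: magnus_cone_iff)
  have "w \<noteq> []" using w(1) magnus_Nil[OF H x g] by auto
  note lc = magnus_inv_leading_coeff[OF g this w(2)]
  show False
    \<comment> \<open>Minimality on both sides excludes that one leading monomial precedes the
      other; if they agree, the two positive coefficients would be negatives of each other.\<close>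
    using lenlex_less_than_linear[of w' w] lc w'(1) w'(2)[of w] w(1) \<open>w \<noteq> []\<close> by auto
qed

end

section \<open>Automorphisms of the almost-direct product\<close>

text \<open>The conjuncts share one induction: multiplicativity at each step needs the remaining
  product to lie in the carrier.\<close>

lemma hom_foldr_mult:
  assumes "group G" "\<phi> \<in> hom G G" "\<And>i. i \<in> set is \<Longrightarrow> c i \<in> carrier G"
  shows "\<phi> (foldr (\<otimes>\<^bsub>G\<^esub>) (map c is) \<one>\<^bsub>G\<^esub>) = foldr (\<otimes>\<^bsub>G\<^esub>) (map (\<phi> \<circ> c) is) \<one>\<^bsub>G\<^esub> \<and>
    foldr (\<otimes>\<^bsub>G\<^esub>) (map c is) \<one>\<^bsub>G\<^esub> \<in> carrier G"
proof -
  interpret group G by fact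
  show ?thesis
    using assms(3) by (induction "is") (auto simp: hom_mult[OF assms(2)] hom_one[OF assms(2)] assms(1))
qed

lemma normal_form_hom:
  assumes "group G" "\<phi> \<in> hom G G" "\<forall>i\<in>{1..k}. F i \<subseteq> carrier G" "\<forall>i\<in>{1..k}. \<phi> ` F i \<subseteq> F i"
    and "normal_form G k F g c"
  shows "normal_form G k F (\<phi> g) (\<phi> \<circ> c)"
proof -
  have "c i \<in> carrier G" if "i \<in> set (rev [1..<Suc k])" for i
    using that assms(3,5) by (fastforce simp: normal_form_def)
  from hom_foldr_mult[of G \<phi> "rev [1..<Suc k]" c, OF assms(1,2) this] show ?thesis
    using assms(4,5) by (auto simp: normal_form_def simp del: upt_Suc)
qed

text \<open>The cones are kept abstract. The equivalence in the last hypothesis serves both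
  inclusions: one direction moves the leading factor forward, the other pulls it back.\<close>

lemma lex_cone_hom_image:
  assumes G: "group G" "\<phi> \<in> iso G G" and F: "\<forall>j\<in>{1..k}. F j \<subseteq> carrier G" "\<forall>j\<in>{1..k}. \<phi> ` F j = F j"
    and C: "\<forall>j\<in>{1..k}. \<forall>g\<in>F j. \<phi> g \<in> C j \<longleftrightarrow> g \<in> C j"
  shows "\<phi> ` lex_cone G k F C = lex_cone G k F C"
proof
  interpret group G by fact
  have hom: "\<phi> \<in> hom G G" and bij: "bij_betw \<phi> (carrier G) (carrier G)"
    using G(2) by (simp_all add: iso_def)
  have \<phi>1: "\<phi> \<one>\<^bsub>G\<^esub> = \<one>\<^bsub>G\<^esub>" by (rule hom_one[OF hom G(1) G(1)])
  show "\<phi> ` lex_cone G k F C \<subseteq> lex_cone G k F C"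
  proof
    fix y assume "y \<in> \<phi> ` lex_cone G k F C"
    then obtain g c j where g: "y = \<phi> g" "g \<in> carrier G" "normal_form G k F g c"
      and j: "j \<in> {1..k}" "c j \<in> C j" "\<forall>i\<in>{1..k}. i > j \<longrightarrow> c i = \<one>\<^bsub>G\<^esub>"
      by (auto simp: lex_cone_def)
    have "normal_form G k F y (\<phi> \<circ> c)"
      using normal_form_hom[OF G(1) hom F(1) _ g(3)] F(2) g(1) by simp
    moreover have "(\<phi> \<circ> c) j \<in> C j"
      using C j g(3) by (simp add: normal_form_def)
    moreover have "\<forall>i\<in>{1..k}. i > j \<longrightarrow> (\<phi> \<circ> c) i = \<one>\<^bsub>G\<^esub>"
      using j(3) \<phi>1 by simp
    moreover have "y \<in> carrier G" using g hom by (auto simp: hom_def)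
    ultimately show "y \<in> lex_cone G k F C"
      using j(1) unfolding lex_cone_def by blast
  qed
  show "lex_cone G k F C \<subseteq> \<phi> ` lex_cone G k F C"
  proof
    fix y assume "y \<in> lex_cone G k F C"
    then obtain c j where y: "y \<in> carrier G" "normal_form G k F y c"
      and j: "j \<in> {1..k}" "c j \<in> C j" "\<forall>i\<in>{1..k}. i > j \<longrightarrow> c i = \<one>\<^bsub>G\<^esub>"
      by (auto simp: lex_cone_def)
    have cF: "\<forall>i\<in>{1..k}. c i \<in> F i" using y(2) by (simp add: normal_form_def)
    \<comment> \<open>Preimages are chosen factor by factor, each inside its own free factor, so
      their product is a preimage of \<open>y\<close> already in normal form.\<close>
    have "\<forall>i\<in>{1..k}. \<exists>e. e \<in> F i \<and> \<phi> e = c i"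
      using F(2) cF by (metis imageE)
    then obtain d where d: "d i \<in> F i" "\<phi> (d i) = c i" if "i \<in> {1..k}" for i
      by metis
    define g where "g = foldr (\<otimes>\<^bsub>G\<^esub>) (map d (rev [1..<Suc k])) \<one>\<^bsub>G\<^esub>"
    have nf: "normal_form G k F g d" using d by (simp add: normal_form_def g_def)
    have cd: "map c (rev [1..<Suc k]) = map (\<phi> \<circ> d) (rev [1..<Suc k])"
      using d by (auto simp del: upt_Suc)
    have "d i \<in> carrier G" if "i \<in> set (rev [1..<Suc k])" for i
      using d(1)[of i] F(1) that by (auto simp del: upt_Suc)
    from hom_foldr_mult[of G \<phi> "rev [1..<Suc k]" d, OF G(1) hom this]
    have hg: "\<phi> g = foldr (\<otimes>\<^bsub>G\<^esub>) (map c (rev [1..<Suc k])) \<one>\<^bsub>G\<^esub>" "g \<in> carrier G"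
      by (simp_all only: cd g_def)
    have "y = \<phi> g"
      using hg y(2) by (simp only: normal_form_def)
    have "d j \<in> C j" using C j(1,2) d[OF j(1)] by metis
    \<comment> \<open>Injectivity of \<open>\<phi>\<close> makes the factors above the leading index
      trivial before \<open>\<phi>\<close> is applied.\<close>
    moreover have "d i = \<one>\<^bsub>G\<^esub>" if "i \<in> {1..k}" "i > j" for i
    proof -
      have "\<phi> (d i) = \<phi> \<one>\<^bsub>G\<^esub>" using d(2)[OF that(1)] j(3) that \<phi>1 by simp
      moreover have "d i \<in> carrier G" using d(1)[OF that(1)] F(1) that(1) by blast
      ultimately show ?thesis
        by (rule inj_onD[OF bij_betw_imp_inj_on[OF bij] _ _ one_closed])
    qed
    ultimately have "g \<in> lex_cone G k F C"
      unfolding lex_cone_def using hg(2) nf j(1) by (intro CollectI conjI exI[of _ d] bexI[of _ j]) auto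
    then show "y \<in> \<phi> ` lex_cone G k F C"
      using \<open>y = \<phi> g\<close> by blast
  qed
qed

text \<open>Monotonicity yields only the direction from \<open>g\<close> to \<open>\<phi> g\<close>.
  For the converse, if \<open>g\<close> is not positive, totality makes its inverse positive, hence
  also the inverse of \<open>\<phi> g\<close>; asymmetry then contradicts positivity of
  \<open>\<phi> g\<close>.\<close>

lemma order_preserving_cone_iff:
  assumes G: "group G" "\<phi> \<in> iso G G" and F: "subgroup F G" "\<phi> ` F = F"
    and x: "free_basis (G\<lparr>carrier := F\<rparr>) n x" and C_def: "C = magnus_cone (G\<lparr>carrier := F\<rparr>) n x"
    and mono: "monotone_on F (cone_less G C) (cone_less G C) \<phi>" and g: "g \<in> F"
  shows "\<phi> g \<in> C \<longleftrightarrow> g \<in> C"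
proof -
  interpret group G by fact
  interpret F: subgroup F G by fact
  interpret \<phi>: group_hom G G \<phi>
    using G by (simp add: group_hom_def group_hom_axioms_def iso_def)
  have FG: "group (G\<lparr>carrier := F\<rparr>)" by (rule F.subgroup_is_group[OF G(1)])
  have inv: "inv\<^bsub>G\<lparr>carrier := F\<rparr>\<^esub> h = inv\<^bsub>G\<^esub> h" if "h \<in> F" for h
    using m_inv_consistent[OF F(1) that] by simp
  have fwd: "\<phi> h \<in> C" if "h \<in> F" "h \<in> C" for h
  proof -
    \<comment> \<open>Positivity is comparison with the identity, which \<open>\<phi>\<close>
      fixes.\<close>
    have "cone_less G C \<one>\<^bsub>G\<^esub> h" using that by (simp add: cone_less_def)
    then have "cone_less G C (\<phi> \<one>\<^bsub>G\<^esub>) (\<phi> h)"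
      using monotone_onD[OF mono F.one_closed that(1)] by blast
    then show ?thesis using that by (simp add: cone_less_def)
  qed
  have "g \<in> C" if \<phi>g: "\<phi> g \<in> C"
  proof (rule ccontr)
    assume "g \<notin> C"
    have "\<phi> g \<noteq> \<one>\<^bsub>G\<^esub>" using \<phi>g by (simp add: C_def magnus_cone_def)
    then have "g \<noteq> \<one>\<^bsub>G\<^esub>" by auto
    then have "inv\<^bsub>G\<^esub> g \<in> C"
      using magnus_cone_total[OF FG x, of g] \<open>g \<notin> C\<close> g inv by (simp add: C_def)
    then have "inv\<^bsub>G\<^esub> (\<phi> g) \<in> C" using fwd[of "inv\<^bsub>G\<^esub> g"] g by simp
    moreover have "\<phi> g \<in> F" using F(2) g by blast
    ultimately show False
      using magnus_cone_asym[OF FG x, of "\<phi> g"] \<phi>g inv by (simp add: C_def)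
  qed
  then show ?thesis using fwd g by blast
qed

theorem proposition9:
  fixes G :: "('a, 'b) monoid_scheme"
    and k :: nat and n :: "nat \<Rightarrow> nat"
    and F :: "nat \<Rightarrow> 'a set"
    and x :: "nat \<Rightarrow> nat \<Rightarrow> 'a"
    and \<phi> :: "'a \<Rightarrow> 'a"
  assumes "almost_direct_product G k n F"
    and "\<forall>j\<in>{1..k}. free_basis (G\<lparr>carrier := F j\<rparr>) (n j) (x j)"
    and "\<phi> \<in> iso G G"
    and "\<forall>j\<in>{1..k}. \<phi> ` F j = F j"
    and "\<forall>j\<in>{1..k}.
           let less = cone_less G (magnus_cone (G\<lparr>carrier := F j\<rparr>) (n j) (x j))
           in monotone_on (F j) less less \<phi>"
  shows "let P = lex_cone G k F (\<lambda>j. magnus_cone (G\<lparr>carrier := F j\<rparr>) (n j) (x j))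
         in \<phi> ` P = P \<and> monotone_on (carrier G) (cone_less G P) (cone_less G P) \<phi>"
proof -
  let ?C = "\<lambda>j. magnus_cone (G\<lparr>carrier := F j\<rparr>) (n j) (x j)"
  have G: "group G" and sub: "\<forall>j\<in>{1..k}. subgroup (F j) G"
    using assms(1) by (simp_all add: almost_direct_product_def)
  interpret \<phi>: group_hom G G \<phi>
    using G assms(3) by (simp add: group_hom_def group_hom_axioms_def iso_def)
  define P where "P = lex_cone G k F ?C"
  have "\<phi> ` P = P"
    unfolding P_def
  proof (rule lex_cone_hom_image[OF G assms(3) _ assms(4)])
    show "\<forall>j\<in>{1..k}. F j \<subseteq> carrier G" using sub subgroup.subset by blast
    show "\<forall>j\<in>{1..k}. \<forall>g\<in>F j. \<phi> g \<in> ?C j \<longleftrightarrow> g \<in> ?C j"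
    proof (intro ballI)
      fix j g assume j: "j \<in> {1..k}" and g: "g \<in> F j"
      show "\<phi> g \<in> ?C j \<longleftrightarrow> g \<in> ?C j"
        by (rule order_preserving_cone_iff[OF G assms(3) _ _ _ refl _ g])
          (use sub assms(2,4,5) j in \<open>simp_all add: Let_def\<close>)
    qed
  qed
  moreover have "monotone_on (carrier G) (cone_less G P) (cone_less G P) \<phi>"
  proof (rule monotone_onI)
    fix g h assume "g \<in> carrier G" "h \<in> carrier G" "cone_less G P g h"
    \<comment> \<open>Since \<open>\<phi>\<close> commutes with products and inverses, monotonicity
      reduces to \<open>\<phi>\<close> mapping \<open>P\<close> into itself.\<close>
    then have "\<phi> (inv\<^bsub>G\<^esub> g \<otimes>\<^bsub>G\<^esub> h) \<in> P"
      using imageI[of "inv\<^bsub>G\<^esub> g \<otimes>\<^bsub>G\<^esub> h" P \<phi>] \<open>\<phi> ` P = P\<close> by (simp add: cone_less_def)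
    then show "cone_less G P (\<phi> g) (\<phi> h)"
      using \<open>g \<in> carrier G\<close> \<open>h \<in> carrier G\<close> by (simp add: cone_less_def)
  qed
  ultimately show ?thesis by (simp add: P_def Let_def)
qed

end
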